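(* For any $t\in\mathbb{C}$ and any $f,g\in\mathbb{C}[\xi,z]$, one has $$\Phi_t(f\ast_t g)=\Phi_t(f)\,\Phi_t(g),$$ where the product on the right-hand side is the usual product of polynomials.
   Context: Let $\xi=(\xi_1,\dots,\xi_n)$ and $z=(z_1,\dots,z_n)$ be $2n$ commuting free variables, $\partial_i=\partial/\partial z_i$, $\delta_i=\partial/\partial \xi_i$. On the vector space $\mathbb{C}[\xi,z]$ define, for $t\in\mathbb{C}$, the product $f\ast_t g:=\mu\big(e^{-t\Omega}(f\otimes g)\big)$, where $\Omega=\sum_{i=1}^n(\partial_i\otimes\delta_i+\delta_i\otimes\partial_i)$ acts (locally nilpotently) on $\mathbb{C}[\xi,z]\otimes\mathbb{C}[\xi,z]$ and $\mu(f\otimes g)=fg$ is the usual multiplication of polynomials. Let $\Lambda:=\sum_{i=1}^n\delta_i\partial_i$, a locally nilpotent operator on $\mathbb{C}[\xi,z]$, and $\Phi_t:=e^{t\Lambda}=\sum_{m\ge0}\frac{t^m\Lambda^m}{m!}$, a linear bijection of $\mathbb{C}[\xi,z]$ with inverse $\Phi_{-t}$. *)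

theory Defs
  imports Complex_Main "HOL-Library.Poly_Mapping"
begin

text \<open>
  Polynomials in the $2n$ variables $\xi_i$, $z_i$, where $n$ is the cardinality of the
  finite type \<open>'n\<close>: \<open>Inl i\<close> stands for $\xi_i$ and \<open>Inr i\<close> for $z_i$. The multiplication
  \<open>*\<close> on \<open>'n cpoly\<close> is the convolution product of \<open>Poly_Mapping\<close>, i.e. the usual
  product of polynomials.
\<close>

type_synonym 'n mon = "('n + 'n) \<Rightarrow>\<^sub>0 nat"
type_synonym 'n cpoly = "'n mon \<Rightarrow>\<^sub>0 complex"

definition scale :: "complex \<Rightarrow> ('a \<Rightarrow>\<^sub>0 complex) \<Rightarrow> ('a \<Rightarrow>\<^sub>0 complex)"
  where "scale c u = Poly_Mapping.map ((*) c) u"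

text \<open>The linear map sending each basis vector \<open>single k 1\<close> to \<open>b k\<close>.\<close>

definition lin_ext :: "('a \<Rightarrow> 'b \<Rightarrow>\<^sub>0 complex) \<Rightarrow> ('a \<Rightarrow>\<^sub>0 complex) \<Rightarrow> ('b \<Rightarrow>\<^sub>0 complex)"
  where "lin_ext b u = (\<Sum>k\<in>Poly_Mapping.keys u. scale (Poly_Mapping.lookup u k) (b k))"

text \<open>
  $\partial x^a/\partial x_v = a_v x^{a - e_v}$. Subtraction of exponents is truncated, but
  for $a_v = 0$ the coefficient vanishes.
\<close>

definition pdiff :: "'n + 'n \<Rightarrow> 'n cpoly \<Rightarrow> 'n cpoly"
  where "pdiff v = lin_ext (\<lambda>a. Poly_Mapping.single (a - Poly_Mapping.single v 1)
                                 (of_nat (Poly_Mapping.lookup a v)))"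

abbreviation delta :: "'n \<Rightarrow> 'n cpoly \<Rightarrow> 'n cpoly"
  where "delta i \<equiv> pdiff (Inl i)"

abbreviation partial :: "'n \<Rightarrow> 'n cpoly \<Rightarrow> 'n cpoly"
  where "partial i \<equiv> pdiff (Inr i)"

text \<open>
  The tensor product of the spaces with bases \<open>'a\<close> and \<open>'b\<close> is the space with basis
  \<open>'a \<times> 'b\<close>, where \<open>(a, b)\<close> stands for $a \otimes b$. A tensor product of linear operators
  is determined by its values on this basis; see \<open>tensor_map_tensor\<close> and \<open>mu_tensor\<close>
  below for the action on arbitrary pure tensors.
\<close>

definition tensor ::
    "('a \<Rightarrow>\<^sub>0 complex) \<Rightarrow> ('b \<Rightarrow>\<^sub>0 complex) \<Rightarrow> ('a \<times> 'b \<Rightarrow>\<^sub>0 complex)"  (infixr "\<otimes>" 72)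
  where "f \<otimes> g = (\<Sum>a\<in>Poly_Mapping.keys f. \<Sum>b\<in>Poly_Mapping.keys g.
           Poly_Mapping.single (a, b) (Poly_Mapping.lookup f a * Poly_Mapping.lookup g b))"

definition tensor_map ::
    "(('a \<Rightarrow>\<^sub>0 complex) \<Rightarrow> ('c \<Rightarrow>\<^sub>0 complex)) \<Rightarrow> (('b \<Rightarrow>\<^sub>0 complex) \<Rightarrow> ('d \<Rightarrow>\<^sub>0 complex)) \<Rightarrow>
     ('a \<times> 'b \<Rightarrow>\<^sub>0 complex) \<Rightarrow> ('c \<times> 'd \<Rightarrow>\<^sub>0 complex)"
  where "tensor_map D E =
           lin_ext (\<lambda>(a, b). D (Poly_Mapping.single a 1) \<otimes> E (Poly_Mapping.single b 1))"

definition mu :: "('n mon \<times> 'n mon \<Rightarrow>\<^sub>0 complex) \<Rightarrow> 'n cpoly"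
  where "mu = lin_ext (\<lambda>(a, b). Poly_Mapping.single a 1 * Poly_Mapping.single b 1)"

text \<open>
  $e^{tD}$ for a locally nilpotent operator $D$. \<open>Sum_any\<close> sums the finitely many nonzero
  terms; see \<open>finite_Lambda\<close> and \<open>finite_Omega\<close> for the local nilpotency of the operators
  to which it is applied.
\<close>

definition exp_op :: "complex \<Rightarrow> (('a \<Rightarrow>\<^sub>0 complex) \<Rightarrow> ('a \<Rightarrow>\<^sub>0 complex)) \<Rightarrow>
    ('a \<Rightarrow>\<^sub>0 complex) \<Rightarrow> ('a \<Rightarrow>\<^sub>0 complex)"
  where "exp_op t D u = Sum_any (\<lambda>m. scale (t ^ m / fact m) ((D ^^ m) u))"

definition Omega ::
    "('n::finite mon \<times> 'n mon \<Rightarrow>\<^sub>0 complex) \<Rightarrow> ('n mon \<times> 'n mon \<Rightarrow>\<^sub>0 complex)"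
  where "Omega u = (\<Sum>i\<in>UNIV. tensor_map (partial i) (delta i) u +
                               tensor_map (delta i) (partial i) u)"

definition star :: "complex \<Rightarrow> 'n::finite cpoly \<Rightarrow> 'n cpoly \<Rightarrow> 'n cpoly"
  where "star t f g = mu (exp_op (- t) Omega (f \<otimes> g))"

definition Lambda :: "'n::finite cpoly \<Rightarrow> 'n cpoly"
  where "Lambda f = (\<Sum>i\<in>UNIV. delta i (partial i f))"

definition Phi :: "complex \<Rightarrow> 'n::finite cpoly \<Rightarrow> 'n cpoly"
  where "Phi t = exp_op t Lambda"

lemma lookup_scale [simp]: "Poly_Mapping.lookup (scale c u) k = c * Poly_Mapping.lookup u k"
  by (simp add: scale_def Poly_Mapping.map.rep_eq when_def)

lemma vector_space_scale: "vector_space scale"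
  by unfold_locales (auto intro!: poly_mapping_eqI simp: lookup_add algebra_simps)

interpretation cs: vector_space "scale :: complex \<Rightarrow> ('a \<Rightarrow>\<^sub>0 complex) \<Rightarrow> _"
  by (rule vector_space_scale)

abbreviation clinear :: "(('a \<Rightarrow>\<^sub>0 complex) \<Rightarrow> ('b \<Rightarrow>\<^sub>0 complex)) \<Rightarrow> bool"
  where "clinear D \<equiv> Vector_Spaces.linear scale scale D"

lemma clinearI:
  assumes "\<And>u v. D (u + v) = D u + D v" "\<And>c u. D (scale c u) = scale c (D u)"
  shows "clinear D"
  using assms by (simp add: Vector_Spaces.linear_iff vector_space_scale)

lemma clinear_add: "clinear D \<Longrightarrow> D (u + v) = D u + D v"
  and clinear_scale: "clinear D \<Longrightarrow> D (scale c u) = scale c (D u)"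
  by (simp_all add: Vector_Spaces.linear_iff)

lemma clinear_zero: "clinear D \<Longrightarrow> D 0 = 0"
  using clinear_scale[of D 0 0] by simp

lemma clinear_setsum: "clinear D \<Longrightarrow> D (sum h A) = (\<Sum>x\<in>A. D (h x))"
  by (induction A rule: infinite_finite_induct) (simp_all add: clinear_zero clinear_add)

lemma lin_ext_superset:
  assumes "finite A" "Poly_Mapping.keys u \<subseteq> A"
  shows "lin_ext b u = (\<Sum>k\<in>A. scale (Poly_Mapping.lookup u k) (b k))"
  unfolding lin_ext_def using assms
  by (intro sum.mono_neutral_left) (auto simp: in_keys_iff)

lemma clinear_lin_ext: "clinear (lin_ext b)"
proof (rule clinearI)
  fix u v :: "'a \<Rightarrow>\<^sub>0 complex" and c
  let ?A = "Poly_Mapping.keys u \<union> Poly_Mapping.keys v"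
  have "Poly_Mapping.keys (u + v) \<subseteq> ?A" by (rule keys_add)
  then show "lin_ext b (u + v) = lin_ext b u + lin_ext b v"
    by (simp add: lin_ext_superset[where A = ?A] lookup_add cs.scale_left_distrib sum.distrib)
  have "Poly_Mapping.keys (scale c u) \<subseteq> Poly_Mapping.keys u" by (auto simp: in_keys_iff)
  then show "lin_ext b (scale c u) = scale c (lin_ext b u)"
    by (simp add: lin_ext_superset[where A = "Poly_Mapping.keys u"] cs.scale_sum_right)
qed

lemma lin_ext_single [simp]: "lin_ext b (Poly_Mapping.single k c) = scale c (b k)"
  by (simp add: lin_ext_superset[where A = "{k}"])

lemma scale_single [simp]: "scale c (Poly_Mapping.single k d) = Poly_Mapping.single k (c * d)"
  by (rule poly_mapping_eqI) (simp add: lookup_single when_def)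

lemma basis_expansion:
  "u = (\<Sum>k\<in>Poly_Mapping.keys u. scale (Poly_Mapping.lookup u k) (Poly_Mapping.single k 1))"
proof (rule poly_mapping_eqI)
  fix j
  show "Poly_Mapping.lookup u j = Poly_Mapping.lookup
    (\<Sum>k\<in>Poly_Mapping.keys u. scale (Poly_Mapping.lookup u k) (Poly_Mapping.single k 1)) j"
    by (cases "j \<in> Poly_Mapping.keys u")
      (simp_all add: lookup_sum lookup_single when_def if_distrib sum.delta in_keys_iff
        cong: if_cong)
qed

lemma clinear_eq_lin_ext:
  assumes "clinear D"
  shows "D u = lin_ext (\<lambda>k. D (Poly_Mapping.single k 1)) u"
  by (subst basis_expansion[of u])
    (simp add: clinear_setsum[OF assms] clinear_scale[OF assms] lin_ext_def del: scale_single)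

lemma clinear_eqI:
  assumes "clinear D" "clinear E" "\<And>k. D (Poly_Mapping.single k 1) = E (Poly_Mapping.single k 1)"
  shows "D u = E u"
  using clinear_eq_lin_ext[OF assms(1), of u] clinear_eq_lin_ext[OF assms(2), of u] assms(3)
  by simp

lemma clinear_compose: "clinear D \<Longrightarrow> clinear E \<Longrightarrow> clinear (\<lambda>u. D (E u))"
  by (rule clinearI) (simp_all add: clinear_add clinear_scale)

lemma clinear_sum_fun: "(\<And>i. i \<in> A \<Longrightarrow> clinear (D i)) \<Longrightarrow> clinear (\<lambda>u. \<Sum>i\<in>A. D i u)"
  by (rule clinearI) (simp_all add: clinear_add clinear_scale sum.distrib cs.scale_sum_right)

lemma clinear_add_fun: "clinear D \<Longrightarrow> clinear E \<Longrightarrow> clinear (\<lambda>u. D u + E u)"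
  by (rule clinearI) (simp_all add: clinear_add clinear_scale cs.scale_right_distrib algebra_simps)

lemma lookup_tensor [simp]:
  "Poly_Mapping.lookup (f \<otimes> g) (a, b) = Poly_Mapping.lookup f a * Poly_Mapping.lookup g b"
proof -
  have "Poly_Mapping.lookup (f \<otimes> g) (a, b) =
      (\<Sum>a'\<in>Poly_Mapping.keys f. \<Sum>b'\<in>Poly_Mapping.keys g.
        if b' = b then (if a' = a then Poly_Mapping.lookup f a' * Poly_Mapping.lookup g b' else 0)
        else 0)"
    unfolding tensor_def lookup_sum lookup_single when_def
    by (intro sum.cong refl) auto
  also have "\<dots> = Poly_Mapping.lookup f a * Poly_Mapping.lookup g b"
    by (cases "Poly_Mapping.lookup g b = 0") (simp_all add: sum.delta in_keys_iff)
  finally show ?thesis .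
qed

lemma tensor_eqI:
  assumes "\<And>a b. Poly_Mapping.lookup u (a, b) = Poly_Mapping.lookup v (a, b)"
  shows "u = v"
  using assms by (intro poly_mapping_eqI) (auto simp: split_paired_all)

lemma clinear_tensor_left: "clinear (\<lambda>f. f \<otimes> g)"
  by (rule clinearI; rule tensor_eqI) (simp_all add: lookup_add algebra_simps)

lemma clinear_tensor_right: "clinear (\<lambda>g. f \<otimes> g)"
  by (rule clinearI; rule tensor_eqI) (simp_all add: lookup_add algebra_simps)

lemma tensor_single:
  "Poly_Mapping.single a c \<otimes> Poly_Mapping.single b d = Poly_Mapping.single (a, b) (c * d)"
  by (rule tensor_eqI) (simp add: lookup_single when_def)

lemma clinear_tensor_map: "clinear (tensor_map D E)"
  unfolding tensor_map_def by (rule clinear_lin_ext)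

lemma tensor_map_single: "tensor_map D E (Poly_Mapping.single (a, b) c) =
    scale c (D (Poly_Mapping.single a 1) \<otimes> E (Poly_Mapping.single b 1))"
  by (simp add: tensor_map_def)

lemma tensor_map_tensor:
  assumes "clinear D" "clinear E"
  shows "tensor_map D E (f \<otimes> g) = D f \<otimes> E g"
proof (rule clinear_eqI[of "\<lambda>f. tensor_map D E (f \<otimes> g)" "\<lambda>f. D f \<otimes> E g"])
  show "clinear (\<lambda>f. tensor_map D E (f \<otimes> g))"
    by (rule clinear_compose[OF clinear_tensor_map clinear_tensor_left])
  show "clinear (\<lambda>f. D f \<otimes> E g)"
    by (rule clinear_compose[OF clinear_tensor_left assms(1)])
  show "tensor_map D E (Poly_Mapping.single a 1 \<otimes> g) = D (Poly_Mapping.single a 1) \<otimes> E g" for a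
    by (rule clinear_eqI[of "\<lambda>g. tensor_map D E (Poly_Mapping.single a 1 \<otimes> g)"
          "\<lambda>g. D (Poly_Mapping.single a 1) \<otimes> E g"])
      (simp_all add: clinear_compose[OF clinear_tensor_map clinear_tensor_right]
        clinear_compose[OF clinear_tensor_right assms(2)] tensor_single tensor_map_single)
qed

lemma clinear_mu: "clinear mu"
  unfolding mu_def by (rule clinear_lin_ext)

lemma mu_single: "mu (Poly_Mapping.single (a, b) c) =
    scale c (Poly_Mapping.single a 1 * Poly_Mapping.single b 1)"
  by (simp add: mu_def del: scale_single)

lemma scale_mult_left: "scale c (f * g) = scale c f * (g :: 'n cpoly)"
  by (simp add: scale_def mult_map_scale_conv_mult mult.assoc)

lemma mu_tensor: "mu (f \<otimes> g) = f * g"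
proof (rule clinear_eqI[of "\<lambda>f. mu (f \<otimes> g)" "\<lambda>f. f * g"])
  have l: "clinear (\<lambda>f. f * g)" for g :: "'n cpoly"
    by (rule clinearI) (simp_all add: scale_mult_left algebra_simps)
  have r: "clinear (\<lambda>g. f * g)" for f :: "'n cpoly"
    using l[of f] by (simp add: mult.commute)
  show "clinear (\<lambda>f. mu (f \<otimes> g))"
    by (rule clinear_compose[OF clinear_mu clinear_tensor_left])
  show "clinear (\<lambda>f. f * g)" by (rule l)
  show "mu (Poly_Mapping.single a 1 \<otimes> g) = Poly_Mapping.single a 1 * g" for a
    by (rule clinear_eqI[of "\<lambda>g. mu (Poly_Mapping.single a 1 \<otimes> g)"
          "\<lambda>g. Poly_Mapping.single a 1 * g"])
      (simp_all add: clinear_compose[OF clinear_mu clinear_tensor_right] r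
        tensor_single mu_single)
qed

text \<open>\<open>Lambda\<close> and \<open>Omega\<close> are locally nilpotent because they lower the total degree.\<close>

lemma finite_iterates:
  fixes w :: "'a \<Rightarrow> nat"
  assumes D: "clinear D"
    and dec: "\<And>k j. j \<in> Poly_Mapping.keys (D (Poly_Mapping.single k 1)) \<Longrightarrow> w j < w k"
  shows "finite {m. (D ^^ m) u \<noteq> 0}"
proof -
  obtain B where B: "\<And>k. k \<in> Poly_Mapping.keys u \<Longrightarrow> w k \<le> B"
    using finite_imageI[OF finite_keys[of u], of w] finite_nat_set_iff_bounded_le by fastforce
  have step: "\<exists>k\<in>Poly_Mapping.keys v. w j < w k" if "j \<in> Poly_Mapping.keys (D v)" for v j
  proof -
    have "j \<in> Poly_Mapping.keys (\<Sum>k\<in>Poly_Mapping.keys v.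
        scale (Poly_Mapping.lookup v k) (D (Poly_Mapping.single k 1)))"
      using that clinear_eq_lin_ext[OF D, of v] by (simp add: lin_ext_def)
    then obtain k where "k \<in> Poly_Mapping.keys v"
      "j \<in> Poly_Mapping.keys (scale (Poly_Mapping.lookup v k) (D (Poly_Mapping.single k 1)))"
      using keys_sum by fastforce
    then show ?thesis using dec[of j k] by (auto simp: in_keys_iff)
  qed
  have bound: "w j + m \<le> B" if "j \<in> Poly_Mapping.keys ((D ^^ m) u)" for j m
    using that
  proof (induction m arbitrary: j)
    case 0
    then show ?case using B by simp
  next
    case (Suc m)
    then obtain k where "k \<in> Poly_Mapping.keys ((D ^^ m) u)" "w j < w k"
      using step by fastforce
    then show ?case using Suc.IH[of k] by simp
  qed
  have "{m. (D ^^ m) u \<noteq> 0} \<subseteq> {..B}"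
  proof
    fix m assume "m \<in> {m. (D ^^ m) u \<noteq> 0}"
    then obtain j where "j \<in> Poly_Mapping.keys ((D ^^ m) u)"
      using keys_eq_empty by fastforce
    then show "m \<in> {..B}" using bound by fastforce
  qed
  then show ?thesis by (rule finite_subset) simp
qed

definition tdeg :: "'n::finite mon \<Rightarrow> nat"
  where "tdeg a = (\<Sum>v\<in>UNIV. Poly_Mapping.lookup a v)"

lemma clinear_pdiff: "clinear (pdiff v)"
  unfolding pdiff_def by (rule clinear_lin_ext)

lemma keys_pdiff_single:
  assumes "j \<in> Poly_Mapping.keys (pdiff v (Poly_Mapping.single a c))"
  shows "tdeg j < tdeg a"
proof -
  from assms have j: "j = a - Poly_Mapping.single v 1" and v: "Poly_Mapping.lookup a v \<noteq> 0"
    by (auto simp: pdiff_def split: if_splits)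
  show ?thesis unfolding tdeg_def
    by (rule sum_strict_mono_ex1)
      (use v in \<open>auto simp: j lookup_minus lookup_single when_def intro!: exI[of _ v]\<close>)
qed

lemma keys_pdiff:
  assumes "j \<in> Poly_Mapping.keys (pdiff v f)"
  shows "\<exists>a\<in>Poly_Mapping.keys f. tdeg j < tdeg a"
proof -
  have "j \<in> Poly_Mapping.keys (\<Sum>a\<in>Poly_Mapping.keys f.
      pdiff v (Poly_Mapping.single a (Poly_Mapping.lookup f a)))"
    using assms by (simp add: pdiff_def lin_ext_def[of _ f])
  then obtain a where "a \<in> Poly_Mapping.keys f"
      "j \<in> Poly_Mapping.keys (pdiff v (Poly_Mapping.single a (Poly_Mapping.lookup f a)))"
    using keys_sum by fastforce
  then show ?thesis using keys_pdiff_single by blast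
qed

lemma clinear_Lambda: "clinear Lambda"
  unfolding Lambda_def
  by (rule clinear_sum_fun) (rule clinear_compose[OF clinear_pdiff clinear_pdiff])

lemma finite_Lambda:
  fixes f :: "'n::finite cpoly"
  shows "finite {m. (Lambda ^^ m) f \<noteq> 0}"
proof (rule finite_iterates[where w = tdeg, OF clinear_Lambda])
  fix j k :: "'n mon"
  assume "j \<in> Poly_Mapping.keys (Lambda (Poly_Mapping.single k 1))"
  then obtain i where "j \<in> Poly_Mapping.keys (delta i (partial i (Poly_Mapping.single k 1)))"
    unfolding Lambda_def using keys_sum by fastforce
  then obtain l where l: "l \<in> Poly_Mapping.keys (partial i (Poly_Mapping.single k (1::complex)))"
      "tdeg j < tdeg l"
    by (blast dest: keys_pdiff)
  from l(2) keys_pdiff_single[OF l(1)] show "tdeg j < tdeg k" by (rule less_trans)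
qed

lemma clinear_Omega: "clinear Omega"
  unfolding Omega_def
  by (rule clinear_sum_fun) (rule clinear_add_fun[OF clinear_tensor_map clinear_tensor_map])

lemma finite_Omega:
  fixes u :: "'n::finite mon \<times> 'n mon \<Rightarrow>\<^sub>0 complex"
  shows "finite {m. (Omega ^^ m) u \<noteq> 0}"
proof (rule finite_iterates[where w = "\<lambda>(a, b). tdeg a + tdeg b", OF clinear_Omega])
  fix j k :: "'n mon \<times> 'n mon"
  obtain a b where k: "k = (a, b)" by force
  obtain a' b' where j: "j = (a', b')" by force
  have single: "Poly_Mapping.single k (1::complex) = Poly_Mapping.single a 1 \<otimes> Poly_Mapping.single b 1"
    by (simp add: tensor_single k)
  have *: "tdeg a' + tdeg b' < tdeg a + tdeg b"
    if "j \<in> Poly_Mapping.keys (tensor_map (pdiff v) (pdiff w) (Poly_Mapping.single k 1))" for v w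
  proof -
    have "a' \<in> Poly_Mapping.keys (pdiff v (Poly_Mapping.single a 1))"
      "b' \<in> Poly_Mapping.keys (pdiff w (Poly_Mapping.single b 1))"
      using that unfolding single tensor_map_tensor[OF clinear_pdiff clinear_pdiff]
      by (auto simp: in_keys_iff j)
    then show ?thesis by (intro add_strict_mono) (rule keys_pdiff_single; assumption)+
  qed
  assume "j \<in> Poly_Mapping.keys (Omega (Poly_Mapping.single k 1))"
  from subsetD[OF keys_sum this[unfolded Omega_def]] obtain i where
    "j \<in> Poly_Mapping.keys (tensor_map (partial i) (delta i) (Poly_Mapping.single k 1) +
                             tensor_map (delta i) (partial i) (Poly_Mapping.single k 1))"
    by (rule UN_E)
  from subsetD[OF keys_add this]
  have "tdeg a' + tdeg b' < tdeg a + tdeg b"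
    by (rule UnE) (rule *, assumption)+
  then show "(case j of (a, b) \<Rightarrow> tdeg a + tdeg b) < (case k of (a, b) \<Rightarrow> tdeg a + tdeg b)"
    by (simp add: j k)
qed

end

theory Submission
  imports Defs
begin

text \<open>
  Since each $\partial_i$ and $\delta_i$ is a derivation, applying the second-order operator
  $\Lambda$ to a product gives
  $\Lambda(fg) = \Lambda(f)\,g + f\,\Lambda(g) + \mu(\Omega(f \otimes g))$, the mixed terms being
  exactly those collected by $\Omega$. In other words, $\Lambda \circ \mu = \mu \circ T$ with
  $T = \Lambda \otimes 1 + 1 \otimes \Lambda + \Omega$ (\<open>Lambda_mu\<close>). Exponentials respect such
  an intertwining relation (\<open>exp_op_intertwine\<close>), so
  $\Phi_t \circ \mu = \mu \circ e^{tT}$.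

  The three summands of $T$ are constant-coefficient differential operators, hence they commute
  with each other. For commuting locally nilpotent operators the exponential of a sum is the
  composition of the exponentials (\<open>exp_op_add\<close>). The factor $e^{-t\Omega}$ in the definition
  of $f \ast_t g$ therefore cancels the $\Omega$ in $e^{tT}$:
  \[ \Phi_t(f \ast_t g) = \mu(e^{tT} e^{-t\Omega}(f \otimes g))
     = \mu(e^{t(\Lambda \otimes 1 + 1 \otimes \Lambda)}(f \otimes g))
     = \mu(\Phi_t(f) \otimes \Phi_t(g)) = \Phi_t(f)\,\Phi_t(g). \]
\<close>

section \<open>Exponentials of locally nilpotent operators\<close>

text \<open>
  Requiring all powers from \<open>N\<close> on to vanish, instead of just one, lets finitely many bounds
  be combined by taking an upper bound.
\<close>

definition locally_nilpotent :: "(('a \<Rightarrow>\<^sub>0 complex) \<Rightarrow> ('a \<Rightarrow>\<^sub>0 complex)) \<Rightarrow> bool"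
  where "locally_nilpotent D \<longleftrightarrow> (\<forall>u. \<exists>N. \<forall>m\<ge>N. (D ^^ m) u = 0)"

definition exp_term :: "complex \<Rightarrow> (('a \<Rightarrow>\<^sub>0 complex) \<Rightarrow> ('a \<Rightarrow>\<^sub>0 complex)) \<Rightarrow> nat \<Rightarrow>
    ('a \<Rightarrow>\<^sub>0 complex) \<Rightarrow> ('a \<Rightarrow>\<^sub>0 complex)"
  where "exp_term t D m u = scale (t ^ m / fact m) ((D ^^ m) u)"

lemma locally_nilpotentI_finite:
  assumes "\<And>u. finite {m. (D ^^ m) u \<noteq> 0}"
  shows "locally_nilpotent D"
  unfolding locally_nilpotent_def
proof
  fix u
  obtain B where "\<forall>m\<in>{m. (D ^^ m) u \<noteq> 0}. m \<le> B"
    using assms finite_nat_set_iff_bounded_le by blast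
  then have "\<forall>m\<ge>Suc B. (D ^^ m) u = 0" by fastforce
  then show "\<exists>N. \<forall>m\<ge>N. (D ^^ m) u = 0" ..
qed

lemma clinear_id: "clinear (\<lambda>u. u)"
  by (rule clinearI) simp_all

lemma clinear_uminus: "clinear D \<Longrightarrow> clinear (\<lambda>u. - D u)"
  by (rule clinearI) (simp_all add: clinear_add clinear_scale)

lemma clinear_funpow:
  fixes D :: "('a \<Rightarrow>\<^sub>0 complex) \<Rightarrow> ('a \<Rightarrow>\<^sub>0 complex)"
  assumes "clinear D"
  shows "clinear (D ^^ m)"
proof (induction m)
  case 0
  have "D ^^ 0 = (\<lambda>u. u)" by (simp add: fun_eq_iff)
  then show ?case by (simp only: clinear_id)
next
  case (Suc m)
  have "clinear (\<lambda>u. D ((D ^^ m) u))"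
    by (rule clinear_compose[OF assms Suc.IH])
  moreover have "D ^^ Suc m = (\<lambda>u. D ((D ^^ m) u))" by (simp add: fun_eq_iff)
  ultimately show ?case by simp
qed

lemma clinear_exp_term:
  assumes "clinear D"
  shows "clinear (exp_term t D m)"
proof (rule clinearI)
  fix u v c
  note lin = clinear_funpow[OF assms, of m]
  show "exp_term t D m (u + v) = exp_term t D m u + exp_term t D m v"
    by (simp only: exp_term_def clinear_add[OF lin] cs.scale_right_distrib)
  show "exp_term t D m (scale c u) = scale c (exp_term t D m u)"
    by (simp only: exp_term_def clinear_scale[OF lin] cs.scale_left_commute)
qed

lemma exp_term_eq_0: "(D ^^ m) u = 0 \<Longrightarrow> exp_term t D m u = 0"
  by (simp add: exp_term_def)

lemma exp_op_eq_sum: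
  assumes "\<And>m. m \<ge> N \<Longrightarrow> (D ^^ m) u = 0"
  shows "exp_op t D u = (\<Sum>m<N. exp_term t D m u)"
proof -
  have "{m. exp_term t D m u \<noteq> 0} \<subseteq> {..<N}"
  proof
    fix m assume "m \<in> {m. exp_term t D m u \<noteq> 0}"
    then have "(D ^^ m) u \<noteq> 0" by (auto simp: exp_term_def)
    with assms show "m \<in> {..<N}" by (meson lessThan_iff not_less)
  qed
  then show ?thesis
    unfolding exp_op_def exp_term_def[symmetric]
    by (intro Sum_any.expand_superset) simp_all
qed

lemma funpow_intertwine:
  assumes "\<And>u. D (F u) = F (E u)"
  shows "(D ^^ m) (F u) = F ((E ^^ m) u)"
  by (induction m) (simp_all add: assms)

text \<open>
  This serves three times: with \<open>F\<close> the multiplication \<open>mu\<close>, and with \<open>F\<close> each of the maps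
  $f \mapsto f \otimes g$ and $g \mapsto f \otimes g$, along which the operators on the tensor square
  reduce to \<open>Lambda\<close>.
\<close>

lemma exp_op_intertwine:
  assumes F: "clinear F" and E: "locally_nilpotent E" and DF: "\<And>u. D (F u) = F (E u)"
  shows "exp_op t D (F u) = F (exp_op t E u)"
proof -
  obtain N where N: "\<And>m. m \<ge> N \<Longrightarrow> (E ^^ m) u = 0"
    using E unfolding locally_nilpotent_def by blast
  then have "\<And>m. m \<ge> N \<Longrightarrow> (D ^^ m) (F u) = 0"
    by (simp add: funpow_intertwine[of D F E, OF DF] clinear_zero[OF F])
  then have "exp_op t D (F u) = (\<Sum>m<N. exp_term t D m (F u))"
    by (rule exp_op_eq_sum)
  also have "\<dots> = F (\<Sum>m<N. exp_term t E m u)"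
    by (simp add: clinear_setsum[OF F] exp_term_def clinear_scale[OF F]
        funpow_intertwine[of D F E, OF DF])
  also have "(\<Sum>m<N. exp_term t E m u) = exp_op t E u"
    by (rule exp_op_eq_sum[symmetric]) (rule N)
  finally show ?thesis .
qed

lemma funpow_uminus:
  fixes D :: "('a \<Rightarrow>\<^sub>0 complex) \<Rightarrow> ('a \<Rightarrow>\<^sub>0 complex)"
  assumes "clinear D"
  shows "((\<lambda>u. - D u) ^^ m) u = scale ((- 1) ^ m) ((D ^^ m) u)"
  by (induction m) (simp_all add: clinear_scale[OF assms])

lemma locally_nilpotent_uminus:
  "clinear D \<Longrightarrow> locally_nilpotent D \<Longrightarrow> locally_nilpotent (\<lambda>u. - D u)"
  by (simp add: locally_nilpotent_def funpow_uminus)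

lemma exp_op_uminus:
  assumes "clinear D"
  shows "exp_op t (\<lambda>u. - D u) = exp_op (- t) D"
proof -
  have "t ^ m * (- 1) ^ m = (- t) ^ m" for m
    by (simp add: power_mult_distrib[symmetric])
  then show ?thesis
    by (simp add: exp_op_def fun_eq_iff funpow_uminus[OF assms])
qed

text \<open>
  The recurrence $(m+1)\,e_{m+1} = tD\,e_m$ for $e_m = t^m D^m/m!$ lets the binomial theorem be
  proved without binomial coefficients.
\<close>

lemma exp_term_Suc:
  assumes "clinear D"
  shows "scale (of_nat (Suc m)) (exp_term t D (Suc m) u) = scale t (D (exp_term t D m u))"
proof -
  have "of_nat (Suc m) * (t ^ Suc m / fact (Suc m)) = t * (t ^ m / fact m)"
    by (simp add: fact_Suc del: of_nat_Suc)
  then show ?thesis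
    by (simp add: exp_term_def clinear_scale[OF assms] del: of_nat_Suc fact_Suc)
qed

lemma exp_term_commute:
  assumes "clinear B" "\<And>u. A (B u) = B (A u)"
  shows "B (exp_term t A m u) = exp_term t A m (B u)"
  by (simp add: exp_term_def clinear_scale[OF assms(1)] funpow_intertwine[of A B A, OF assms(2)])

text \<open>
  The binomial theorem for commuting operators, with the factorials absorbed into the terms.
  In the induction step both sides are multiplied by $m+1$, and on the right this factor is
  split as $k + (m+1-k)$: the part $k$ comes from applying $A$ and the part $m+1-k$ from
  applying $B$ to the sum for $m$.
\<close>

lemma exp_term_add:
  assumes A: "clinear A" and B: "clinear B" and AB: "\<And>u. A (B u) = B (A u)"
  shows "exp_term t (\<lambda>u. A u + B u) m u = (\<Sum>k\<le>m. exp_term t A k (exp_term t B (m - k) u))"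
proof (induction m)
  case 0
  then show ?case by (simp add: exp_term_def)
next
  case (Suc m)
  let ?T = "\<lambda>u. A u + B u"
  let ?e = "\<lambda>k l. exp_term t A k (exp_term t B l u)"
  have T: "clinear ?T" by (rule clinear_add_fun[OF A B])
  have eA: "scale t (A (?e k l)) = scale (of_nat (Suc k)) (?e (Suc k) l)" for k l
    by (rule exp_term_Suc[OF A, symmetric])
  have eB: "scale t (B (?e k l)) = scale (of_nat (Suc l)) (?e k (Suc l))" for k l
  proof -
    have "scale t (B (?e k l)) = exp_term t A k (scale t (B (exp_term t B l u)))"
      by (simp add: exp_term_commute[of B A, OF B AB] clinear_scale[OF clinear_exp_term[OF A]])
    also have "\<dots> = exp_term t A k (scale (of_nat (Suc l)) (exp_term t B (Suc l) u))"
      by (simp only: exp_term_Suc[OF B])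
    finally show ?thesis by (simp only: clinear_scale[OF clinear_exp_term[OF A]])
  qed
  have "scale (of_nat (Suc m)) (exp_term t ?T (Suc m) u) =
      scale t (A (\<Sum>k\<le>m. ?e k (m - k))) + scale t (B (\<Sum>k\<le>m. ?e k (m - k)))"
    by (simp only: exp_term_Suc[OF T] Suc.IH cs.scale_right_distrib)
  also have "\<dots> = (\<Sum>k\<le>m. scale (of_nat (Suc k)) (?e (Suc k) (m - k))) +
      (\<Sum>k\<le>m. scale (of_nat (Suc (m - k))) (?e k (Suc (m - k))))"
    by (simp only: clinear_setsum[OF A] clinear_setsum[OF B] cs.scale_sum_right eA eB)
  also have "(\<Sum>k\<le>m. scale (of_nat (Suc k)) (?e (Suc k) (m - k))) =
      (\<Sum>k\<le>Suc m. scale (of_nat k) (?e k (Suc m - k)))"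
    by (subst sum.atMost_Suc_shift) simp
  also have "(\<Sum>k\<le>m. scale (of_nat (Suc (m - k))) (?e k (Suc (m - k)))) =
      (\<Sum>k\<le>Suc m. scale (of_nat (Suc m - k)) (?e k (Suc m - k)))"
  proof -
    have "(\<Sum>k\<le>m. scale (of_nat (Suc (m - k))) (?e k (Suc (m - k)))) =
        (\<Sum>k\<le>m. scale (of_nat (Suc m - k)) (?e k (Suc m - k)))"
      by (rule sum.cong) (simp_all only: atMost_iff Suc_diff_le)
    then show ?thesis
      by (simp only: sum.atMost_Suc diff_self_eq_0 of_nat_0 cs.scale_zero_left add_0_right)
  qed
  also have "(\<Sum>k\<le>Suc m. scale (of_nat k) (?e k (Suc m - k))) +
      (\<Sum>k\<le>Suc m. scale (of_nat (Suc m - k)) (?e k (Suc m - k))) =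
      scale (of_nat (Suc m)) (\<Sum>k\<le>Suc m. ?e k (Suc m - k))"
    unfolding sum.distrib[symmetric] cs.scale_sum_right cs.scale_left_distrib[symmetric]
      of_nat_add[symmetric]
    by (rule sum.cong) simp_all
  finally show ?case
    by (rule cs.scale_left_imp_eq[rotated]) (simp del: of_nat_Suc)
qed

text \<open>
  Only finitely many vectors $B^k u$ are nonzero, so the largest of their nilpotency bounds with
  respect to $A$ serves for all of them. This is what makes the double series
  $\sum_{j,k} A^j B^k u$ finite.
\<close>

lemma joint_vanishing_bound:
  assumes A: "clinear A" "locally_nilpotent A" and B: "locally_nilpotent B"
  obtains K where "\<And>j k. j \<ge> K \<or> k \<ge> K \<Longrightarrow> (A ^^ j) ((B ^^ k) u) = 0"
proof -
  obtain N where N: "\<And>k. k \<ge> N \<Longrightarrow> (B ^^ k) u = 0"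
    using B unfolding locally_nilpotent_def by blast
  have "\<forall>k. \<exists>M. \<forall>j\<ge>M. (A ^^ j) ((B ^^ k) u) = 0"
    using A(2) unfolding locally_nilpotent_def by blast
  from choice[OF this] obtain M where M: "\<And>k j. j \<ge> M k \<Longrightarrow> (A ^^ j) ((B ^^ k) u) = 0"
    by blast
  define K where "K = N + (\<Sum>k<N. M k)"
  have M_le: "M k \<le> K" if "k < N" for k
    using member_le_sum[of k "{..<N}" M] that by (simp add: K_def)
  have "N \<le> K" by (simp add: K_def)
  have "(A ^^ j) ((B ^^ k) u) = 0" if "j \<ge> K \<or> k \<ge> K" for j k
  proof (cases "k < N")
    case True
    then have "j \<ge> M k" using that M_le[of k] \<open>N \<le> K\<close> by linarith
    then show ?thesis by (rule M)
  next
    case False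
    then show ?thesis by (simp add: N clinear_zero[OF clinear_funpow[OF A(1)]])
  qed
  then show ?thesis by (rule that)
qed

lemma exp_term_exp_term_eq_0:
  assumes "clinear A" "(A ^^ j) ((B ^^ k) u) = 0"
  shows "exp_term t A j (exp_term t B k u) = 0"
  using assms by (simp add: exp_term_def clinear_scale[OF clinear_funpow])

text \<open>
  If $m \ge 2K$, every term $A^k B^{m-k} u$ of the binomial expansion has an exponent that is
  at least $K$.
\<close>

lemma locally_nilpotent_add:
  assumes A: "clinear A" "locally_nilpotent A" and B: "clinear B" "locally_nilpotent B"
    and AB: "\<And>u. A (B u) = B (A u)"
  shows "locally_nilpotent (\<lambda>u. A u + B u)"
  unfolding locally_nilpotent_def
proof
  fix u
  obtain K where K: "\<And>j k. j \<ge> K \<or> k \<ge> K \<Longrightarrow> (A ^^ j) ((B ^^ k) u) = 0"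
    using joint_vanishing_bound[OF A B(2)] by blast
  have "((\<lambda>u. A u + B u) ^^ m) u = 0" if "m \<ge> 2 * K" for m
  proof -
    have "exp_term 1 A k (exp_term 1 B (m - k) u) = 0" for k
      using that by (intro exp_term_exp_term_eq_0 A K) linarith
    then have "exp_term 1 (\<lambda>u. A u + B u) m u = 0"
      by (simp add: exp_term_add[of A B, OF A(1) B(1) AB])
    then show ?thesis by (simp add: exp_term_def)
  qed
  then show "\<exists>N. \<forall>m\<ge>N. ((\<lambda>u. A u + B u) ^^ m) u = 0" by blast
qed

text \<open>
  Both sides are the same finite double sum over $A^j B^k u$: on the left it is arranged by
  $j + k$ over a triangle, on the right over a square. The terms outside the square with side
  $K$ vanish.
\<close>

lemma exp_op_add:
  assumes A: "clinear A" "locally_nilpotent A" and B: "clinear B" "locally_nilpotent B"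
    and AB: "\<And>u. A (B u) = B (A u)"
  shows "exp_op t (\<lambda>u. A u + B u) u = exp_op t A (exp_op t B u)"
proof -
  let ?T = "\<lambda>u. A u + B u"
  let ?e = "\<lambda>k l. exp_term t A k (exp_term t B l u)"
  obtain K where K: "\<And>j k. j \<ge> K \<or> k \<ge> K \<Longrightarrow> (A ^^ j) ((B ^^ k) u) = 0"
    using joint_vanishing_bound[OF A B(2)] by blast
  obtain N where N: "\<And>m. m \<ge> N \<Longrightarrow> (?T ^^ m) u = 0"
    using locally_nilpotent_add[of A B, OF A B AB] unfolding locally_nilpotent_def by blast
  (* At least N, so that the series of A + B ends before L; at least 2 * K, so that the triangle
     of side L contains the square of side K. *)
  define L where "L = N + 2 * K"
  have e0: "j < K \<and> k < K" if "?e j k \<noteq> 0" for j k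
  proof (rule ccontr)
    assume "\<not> (j < K \<and> k < K)"
    then have "(A ^^ j) ((B ^^ k) u) = 0" by (intro K) linarith
    with that show False by (simp add: exp_term_exp_term_eq_0[OF A(1)])
  qed
  have AL: "(A ^^ j) (exp_op t B u) = 0" if "j \<ge> K" for j
  proof -
    have "(B ^^ k) u = 0" if "k \<ge> K" for k
      using K[of k 0] K[of 0 k] that by simp
    then have "exp_op t B u = (\<Sum>k<K. exp_term t B k u)"
      by (rule exp_op_eq_sum)
    then show ?thesis
      using K that
      by (simp add: clinear_setsum[OF clinear_funpow[OF A(1)]] exp_term_def
          clinear_scale[OF clinear_funpow[OF A(1)]])
  qed
  have "exp_op t ?T u = (\<Sum>m<L. exp_term t ?T m u)"
    by (rule exp_op_eq_sum) (simp add: N L_def)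
  also have "\<dots> = (\<Sum>m<L. \<Sum>k\<le>m. ?e k (m - k))"
    by (simp add: exp_term_add[of A B, OF A(1) B(1) AB])
  also have "\<dots> = (\<Sum>(j, k)\<in>{(j, k). j + k < L}. ?e j k)"
    by (rule sum.triangle_reindex[symmetric])
  also have "\<dots> = (\<Sum>(j, k)\<in>{..<K} \<times> {..<K}. ?e j k)"
  proof (rule sum.mono_neutral_right)
    show "finite {(j, k). j + k < L}"
      by (rule finite_subset[of _ "{..<L} \<times> {..<L}"]) auto
  qed (auto simp: L_def dest: e0)
  also have "\<dots> = (\<Sum>j<K. exp_term t A j (\<Sum>k<K. exp_term t B k u))"
    by (simp add: sum.cartesian_product clinear_setsum[OF clinear_exp_term[OF A(1)]])
  also have "(\<Sum>k<K. exp_term t B k u) = exp_op t B u"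
    by (rule exp_op_eq_sum[symmetric]) (use K[of 0] in simp)
  also have "(\<Sum>j<K. exp_term t A j (exp_op t B u)) = exp_op t A (exp_op t B u)"
    by (rule exp_op_eq_sum[symmetric]) (rule AL)
  finally show ?thesis .
qed

section \<open>Partial derivatives\<close>

lemma pdiff_single:
  "pdiff v (Poly_Mapping.single a c) =
    Poly_Mapping.single (a - Poly_Mapping.single v 1) (c * of_nat (Poly_Mapping.lookup a v))"
  by (simp add: pdiff_def)

lemma pdiff_commute: "pdiff v (pdiff w f) = pdiff w (pdiff v f)"
proof (rule clinear_eqI[of "\<lambda>f. pdiff v (pdiff w f)" "\<lambda>f. pdiff w (pdiff v f)"])
  fix a :: "'a mon"
  show "pdiff v (pdiff w (Poly_Mapping.single a 1)) = pdiff w (pdiff v (Poly_Mapping.single a 1))"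
    by (cases "v = w") (simp_all add: pdiff_single lookup_minus lookup_single diff_right_commute mult.commute)
qed (rule clinear_compose[OF clinear_pdiff clinear_pdiff])+

lemma pdiff_mult: "pdiff v (f * g) = pdiff v f * g + f * pdiff v g"
proof -
  have l: "clinear (\<lambda>f. f * g)" for g :: "'a cpoly"
    by (rule clinearI) (simp_all add: scale_mult_left algebra_simps)
  have r: "clinear (\<lambda>g. f * g)" for f :: "'a cpoly"
    using l[of f] by (simp add: mult.commute)
  let ?e = "Poly_Mapping.single v (1::nat)"
  have monomials: "pdiff v (Poly_Mapping.single a 1 * Poly_Mapping.single b 1) =
      pdiff v (Poly_Mapping.single a 1) * Poly_Mapping.single b 1 +
      Poly_Mapping.single a 1 * pdiff v (Poly_Mapping.single b 1)" for a b :: "'a mon"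
  proof -
    (* Subtraction of exponents is truncated, so c - e + d = c + d - e may fail if v is not in c.
       In that case the coefficient of the corresponding term is zero. *)
    have shift: "c - ?e + d = c + d - ?e" if "Poly_Mapping.lookup c v > 0" for c d :: "'a mon"
      by (rule poly_mapping_eqI) (use that in \<open>auto simp: lookup_add lookup_minus lookup_single when_def\<close>)
    show ?thesis
      using shift[of a b] shift[of b a]
      by (cases "Poly_Mapping.lookup a v = 0"; cases "Poly_Mapping.lookup b v = 0")
        (simp_all add: pdiff_single mult_single lookup_add single_add[symmetric] add.commute)
  qed
  have monomial_left: "pdiff v (Poly_Mapping.single a 1 * g) =
      pdiff v (Poly_Mapping.single a 1) * g + Poly_Mapping.single a 1 * pdiff v g" for a
    by (rule clinear_eqI[of "\<lambda>g. pdiff v (Poly_Mapping.single a 1 * g)"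
        "\<lambda>g. pdiff v (Poly_Mapping.single a 1) * g + Poly_Mapping.single a 1 * pdiff v g"])
      (intro clinear_add_fun clinear_compose[OF clinear_pdiff] clinear_compose[OF r] clinear_pdiff
        r monomials)+
  show ?thesis
    by (rule clinear_eqI[of "\<lambda>f. pdiff v (f * g)" "\<lambda>f. pdiff v f * g + f * pdiff v g"])
      (intro clinear_add_fun clinear_compose[OF clinear_pdiff] clinear_compose[OF l] clinear_pdiff
        l monomial_left)+
qed

lemma pdiff_Lambda: "pdiff v (Lambda f) = Lambda (pdiff v f)"
  unfolding Lambda_def clinear_setsum[OF clinear_pdiff]
  by (simp add: pdiff_commute[of v])

section \<open>Operators on the tensor square\<close>

text \<open>
  Checking identities on pure tensors of arbitrary polynomials, not just of monomials, keeps the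
  exponents out of the computations below.
\<close>

lemma clinear_eqI_tensor:
  assumes "clinear D" "clinear E"
    and "\<And>f g. D (f \<otimes> g) = E (f \<otimes> g)"
  shows "D u = E u"
proof (rule clinear_eqI[OF assms(1,2)])
  fix k :: "'a \<times> 'b"
  have "Poly_Mapping.single k (1::complex) =
      Poly_Mapping.single (fst k) 1 \<otimes> Poly_Mapping.single (snd k) 1"
    by (simp add: tensor_single)
  then show "D (Poly_Mapping.single k 1) = E (Poly_Mapping.single k 1)"
    by (simp add: assms(3))
qed

abbreviation Lambda_left ::
    "('n::finite mon \<times> 'n mon \<Rightarrow>\<^sub>0 complex) \<Rightarrow> ('n mon \<times> 'n mon \<Rightarrow>\<^sub>0 complex)"
  where "Lambda_left \<equiv> tensor_map Lambda (\<lambda>g. g)"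

abbreviation Lambda_right ::
    "('n::finite mon \<times> 'n mon \<Rightarrow>\<^sub>0 complex) \<Rightarrow> ('n mon \<times> 'n mon \<Rightarrow>\<^sub>0 complex)"
  where "Lambda_right \<equiv> tensor_map (\<lambda>f. f) Lambda"

lemma Lambda_left_tensor: "Lambda_left (f \<otimes> g) = Lambda f \<otimes> g"
  by (rule tensor_map_tensor[OF clinear_Lambda clinear_id])

lemma Lambda_right_tensor: "Lambda_right (f \<otimes> g) = f \<otimes> Lambda g"
  by (rule tensor_map_tensor[OF clinear_id clinear_Lambda])

lemma Omega_tensor:
  "Omega (f \<otimes> g) = (\<Sum>i\<in>UNIV. partial i f \<otimes> delta i g + delta i f \<otimes> partial i g)"
  by (simp add: Omega_def tensor_map_tensor clinear_pdiff)

lemma Lambda_left_right_commute: "Lambda_left (Lambda_right u) = Lambda_right (Lambda_left u)"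
proof (rule clinear_eqI_tensor[of "\<lambda>u. Lambda_left (Lambda_right u)" "\<lambda>u. Lambda_right (Lambda_left u)"])
  show "clinear (\<lambda>u. Lambda_left (Lambda_right u))" "clinear (\<lambda>u. Lambda_right (Lambda_left u))"
    by (intro clinear_compose[OF clinear_tensor_map clinear_tensor_map])+
  fix f g :: "'a cpoly"
  show "Lambda_left (Lambda_right (f \<otimes> g)) = Lambda_right (Lambda_left (f \<otimes> g))"
    by (simp add: Lambda_left_tensor Lambda_right_tensor)
qed

lemma Lambda_left_Omega_commute: "Lambda_left (Omega u) = Omega (Lambda_left u)"
proof (rule clinear_eqI_tensor[of "\<lambda>u. Lambda_left (Omega u)" "\<lambda>u. Omega (Lambda_left u)"])
  show "clinear (\<lambda>u. Lambda_left (Omega u))" "clinear (\<lambda>u. Omega (Lambda_left u))"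
    by (intro clinear_compose[OF clinear_tensor_map clinear_Omega]
      clinear_compose[OF clinear_Omega clinear_tensor_map])+
  fix f g :: "'a cpoly"
  show "Lambda_left (Omega (f \<otimes> g)) = Omega (Lambda_left (f \<otimes> g))"
    by (simp add: Omega_tensor Lambda_left_tensor clinear_setsum[OF clinear_tensor_map]
        clinear_add[OF clinear_tensor_map] pdiff_Lambda)
qed

lemma Lambda_right_Omega_commute: "Lambda_right (Omega u) = Omega (Lambda_right u)"
proof (rule clinear_eqI_tensor[of "\<lambda>u. Lambda_right (Omega u)" "\<lambda>u. Omega (Lambda_right u)"])
  show "clinear (\<lambda>u. Lambda_right (Omega u))" "clinear (\<lambda>u. Omega (Lambda_right u))"
    by (intro clinear_compose[OF clinear_tensor_map clinear_Omega]
      clinear_compose[OF clinear_Omega clinear_tensor_map])+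
  fix f g :: "'a cpoly"
  show "Lambda_right (Omega (f \<otimes> g)) = Omega (Lambda_right (f \<otimes> g))"
    by (simp add: Omega_tensor Lambda_right_tensor clinear_setsum[OF clinear_tensor_map]
        clinear_add[OF clinear_tensor_map] pdiff_Lambda)
qed

text \<open>
  The Leibniz rule applied twice: $\delta_i\partial_i(fg)$ has two terms where both derivatives
  hit the same factor and two mixed ones, which are the $i$-th summand of $\Omega(f \otimes g)$.
\<close>

lemma Lambda_mult:
  "Lambda (f * g) = Lambda f * g + f * Lambda g + mu (Omega (f \<otimes> g))"
proof -
  have "Lambda (f * g) = (\<Sum>i\<in>UNIV. delta i (partial i f) * g + f * delta i (partial i g) +
      (partial i f * delta i g + delta i f * partial i g))"
    unfolding Lambda_def
    by (rule sum.cong) (simp_all add: pdiff_mult clinear_add[OF clinear_pdiff] algebra_simps)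
  then show ?thesis
    by (simp add: Lambda_def Omega_tensor clinear_setsum[OF clinear_mu] clinear_add[OF clinear_mu]
        mu_tensor sum.distrib sum_distrib_left sum_distrib_right)
qed

lemma Lambda_mu: "Lambda (mu u) = mu (Lambda_left u + Lambda_right u + Omega u)"
proof (rule clinear_eqI_tensor[of "\<lambda>u. Lambda (mu u)" "\<lambda>u. mu (Lambda_left u + Lambda_right u + Omega u)"])
  show "clinear (\<lambda>u. Lambda (mu u))" "clinear (\<lambda>u. mu (Lambda_left u + Lambda_right u + Omega u))"
    by (intro clinear_compose[OF clinear_Lambda clinear_mu] clinear_compose[OF clinear_mu]
      clinear_add_fun clinear_tensor_map clinear_Omega)+
  fix f g :: "'a cpoly"
  show "Lambda (mu (f \<otimes> g)) = mu (Lambda_left (f \<otimes> g) + Lambda_right (f \<otimes> g) + Omega (f \<otimes> g))"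
    by (simp add: mu_tensor Lambda_mult clinear_add[OF clinear_mu] Lambda_left_tensor
        Lambda_right_tensor)
qed

lemma locally_nilpotent_Lambda: "locally_nilpotent Lambda"
  by (rule locally_nilpotentI_finite) (rule finite_Lambda)

lemma locally_nilpotent_Omega: "locally_nilpotent Omega"
  by (rule locally_nilpotentI_finite) (rule finite_Omega)

text \<open>
  A finite sum of monomial tensors is killed by any power that kills every summand. For
  $\Lambda \otimes 1$ and $1 \otimes \Lambda$ this reduces local nilpotency to that of $\Lambda$.
\<close>

lemma locally_nilpotentI_tensor:
  assumes "clinear D" "\<And>f g. \<exists>N. \<forall>m\<ge>N. (D ^^ m) (f \<otimes> g) = 0"
  shows "locally_nilpotent D"
  unfolding locally_nilpotent_def
proof
  fix u
  have "\<exists>N. \<forall>m\<ge>N. (D ^^ m) (Poly_Mapping.single k 1) = 0" for k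
    using assms(2)[of "Poly_Mapping.single (fst k) 1" "Poly_Mapping.single (snd k) 1"]
    by (simp add: tensor_single)
  then have "\<forall>k. \<exists>N. \<forall>m\<ge>N. (D ^^ m) (Poly_Mapping.single k 1) = 0"
    by blast
  from choice[OF this] obtain N where N: "\<And>k m. m \<ge> N k \<Longrightarrow> (D ^^ m) (Poly_Mapping.single k 1) = 0"
    by blast
  have "(D ^^ m) u = 0" if "m \<ge> (\<Sum>k\<in>Poly_Mapping.keys u. N k)" for m
  proof -
    have "m \<ge> N k" if "k \<in> Poly_Mapping.keys u" for k
      using member_le_sum[of k "Poly_Mapping.keys u" N] that \<open>m \<ge> _\<close> by simp
    then show ?thesis
      by (simp add: clinear_eq_lin_ext[OF clinear_funpow[OF assms(1)], of m u] lin_ext_def N)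
  qed
  then show "\<exists>N. \<forall>m\<ge>N. (D ^^ m) u = 0" by blast
qed

lemma locally_nilpotent_Lambda_left: "locally_nilpotent Lambda_left"
proof (rule locally_nilpotentI_tensor[OF clinear_tensor_map])
  fix f g :: "'a cpoly"
  have "(Lambda_left ^^ m) (f \<otimes> g) = (Lambda ^^ m) f \<otimes> g" for m
    by (rule funpow_intertwine[of _ "\<lambda>f. f \<otimes> g"]) (rule Lambda_left_tensor)
  moreover obtain N where "\<And>m. m \<ge> N \<Longrightarrow> (Lambda ^^ m) f = 0"
    using locally_nilpotent_Lambda unfolding locally_nilpotent_def by blast
  ultimately have "(Lambda_left ^^ m) (f \<otimes> g) = 0" if "m \<ge> N" for m
    using that by (simp add: clinear_zero[OF clinear_tensor_left])
  then show "\<exists>N. \<forall>m\<ge>N. (Lambda_left ^^ m) (f \<otimes> g) = 0" by blast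
qed

lemma locally_nilpotent_Lambda_right: "locally_nilpotent Lambda_right"
proof (rule locally_nilpotentI_tensor[OF clinear_tensor_map])
  fix f g :: "'a cpoly"
  have "(Lambda_right ^^ m) (f \<otimes> g) = f \<otimes> (Lambda ^^ m) g" for m
    by (rule funpow_intertwine[of _ "\<lambda>g. f \<otimes> g"]) (rule Lambda_right_tensor)
  moreover obtain N where "\<And>m. m \<ge> N \<Longrightarrow> (Lambda ^^ m) g = 0"
    using locally_nilpotent_Lambda unfolding locally_nilpotent_def by blast
  ultimately have "(Lambda_right ^^ m) (f \<otimes> g) = 0" if "m \<ge> N" for m
    using that by (simp add: clinear_zero[OF clinear_tensor_right])
  then show "\<exists>N. \<forall>m\<ge>N. (Lambda_right ^^ m) (f \<otimes> g) = 0" by blast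
qed

theorem proposition2p1:
  fixes t :: complex and f g :: "'n::finite cpoly"
  shows "Phi t (star t f g) = Phi t f * Phi t g"
proof -
  let ?L = "\<lambda>u :: 'n mon \<times> 'n mon \<Rightarrow>\<^sub>0 complex. Lambda_left u + Lambda_right u"
  let ?T = "\<lambda>u. ?L u + Omega u"
  have L: "clinear ?L" "locally_nilpotent ?L"
    by (rule clinear_add_fun[OF clinear_tensor_map clinear_tensor_map],
        rule locally_nilpotent_add[of Lambda_left Lambda_right, OF clinear_tensor_map
          locally_nilpotent_Lambda_left clinear_tensor_map locally_nilpotent_Lambda_right
          Lambda_left_right_commute])
  have L_Omega: "?L (Omega u) = Omega (?L u)" for u
    by (simp add: Lambda_left_Omega_commute Lambda_right_Omega_commute clinear_add[OF clinear_Omega])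
  have T: "clinear ?T" "locally_nilpotent ?T"
    by (rule clinear_add_fun[OF L(1) clinear_Omega],
        rule locally_nilpotent_add[of ?L Omega, OF L clinear_Omega locally_nilpotent_Omega L_Omega])
  (* Writing the exponential of - t Omega with the parameter t and the operator - Omega makes it
     composable with the exponential of t T. *)
  have "star t f g = mu (exp_op t (\<lambda>u. - Omega u) (f \<otimes> g))"
    by (simp add: star_def exp_op_uminus[OF clinear_Omega])
  then have "Phi t (star t f g) = mu (exp_op t ?T (exp_op t (\<lambda>u. - Omega u) (f \<otimes> g)))"
    by (simp only: Phi_def exp_op_intertwine[where D = Lambda and F = mu and E = ?T,
          OF clinear_mu T(2) Lambda_mu])
  also have "exp_op t ?T (exp_op t (\<lambda>u. - Omega u) (f \<otimes> g)) =
      exp_op t (\<lambda>u. ?T u + - Omega u) (f \<otimes> g)"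
  proof (rule exp_op_add[of ?T "\<lambda>u. - Omega u", OF T clinear_uminus[OF clinear_Omega]
        locally_nilpotent_uminus[OF clinear_Omega locally_nilpotent_Omega], symmetric])
    show "?T (- Omega u) = - Omega (?T u)" for u
      using clinear_scale[OF T(1), of "- 1" "Omega u"]
      by (simp add: L_Omega clinear_add[OF clinear_Omega])
  qed
  also have "(\<lambda>u. ?T u + - Omega u) = ?L" by simp
  also have "exp_op t ?L (f \<otimes> g) = exp_op t Lambda_left (exp_op t Lambda_right (f \<otimes> g))"
    by (rule exp_op_add[of Lambda_left Lambda_right, OF clinear_tensor_map
          locally_nilpotent_Lambda_left clinear_tensor_map locally_nilpotent_Lambda_right
          Lambda_left_right_commute])
  also have "exp_op t Lambda_right (f \<otimes> g) = f \<otimes> Phi t g"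
    unfolding Phi_def
    by (rule exp_op_intertwine[where D = Lambda_right and F = "\<lambda>g. f \<otimes> g" and E = Lambda,
          OF clinear_tensor_right locally_nilpotent_Lambda
          Lambda_right_tensor])
  also have "exp_op t Lambda_left (f \<otimes> Phi t g) = Phi t f \<otimes> Phi t g"
    unfolding Phi_def
    by (rule exp_op_intertwine[where D = Lambda_left and F = "\<lambda>f. f \<otimes> _" and E = Lambda,
          OF clinear_tensor_left locally_nilpotent_Lambda
          Lambda_left_tensor])
  finally show ?thesis by (simp add: mu_tensor)
qed

end
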